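(* Let $K$ be a field of characteristic $0$, let $m,r_1,\ldots,r_m$ be positive integers, let $\omega_1,\ldots,\omega_m\in K$ with $\omega_i-\omega_j\notin\mathbb{Z}$ for $1\le i<j\le m$, let $n$ be a non-negative integer, and let $k$ be an integer with $1\le k\le r_1+\cdots+r_m$. Write $k=r_1+\cdots+r_u+s_{u+1}$ with $0\le u\le m-1$ and $1\le s_{u+1}\le r_{u+1}$ (where $r_1+\cdots+r_u=0$ if $u=0$). Define the rational function $$F_k(x)=\frac{1}{\prod_{i=1}^u\prod_{h=0}^{n+1}(x-\omega_i-h)^{r_i}}\cdot\frac{1}{(x-\omega_{u+1}-n-1)^{s_{u+1}}}\cdot\frac{1}{\prod_{i'=u+1}^m\prod_{h'=0}^{n}(x-\omega_{i'}-h')^{r_{i'}}},$$ and let $p_{k,h,i,j_i}(\boldsymbol{\omega})\in K$ be the elements such that $$F_k(x)=\sum_{i=1}^m\sum_{h=0}^{n+1}\sum_{j_i=1}^{r_i}\frac{p_{k,h,i,j_i}(\boldsymbol{\omega})}{(x-\omega_i-h)^{j_i}}.$$ Define $$P_{k,i,j_i}(z)=\sum_{h=0}^{n+1}\frac{p_{k,h,i,j_i+1}(\boldsymbol{\omega})}{j_i!}(1+z)^h\qquad(1\le i\le m,\ 0\le j_i\le r_i-1).$$ Then the vector $(P_{k,i,j_i}(z))_{1\le i\le m,\,0\le j_i\le r_i-1}$ is a weight $\boldsymbol{n}_k$ Padé approximant of $((1+z)^{\omega_i}\log^{j_i}(1+z))_{1\le i\le m,\,0\le j_i\le r_i-1}$,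 where $$\boldsymbol{n}_k=(\underbrace{n+1,\ldots,n+1}_{k},n,\ldots,n)\in\mathbb{Z}_{\ge0}^{r_1+\cdots+r_m}.$$
   Context: For $f=\sum_k a_kz^k\in K[[z]]$, ${\rm ord}\,f=\min\{k\mid a_k\neq0\}$ (and $\infty$ if $f=0$). Let $\boldsymbol{f}=(f_1,\ldots,f_q)\in K[[z]]^q$ and $\boldsymbol{w}=(w_1,\ldots,w_q)\in\mathbb{Z}_{\ge0}^q$. A tuple $(P_1,\ldots,P_q)\in K[z]^q$ is a weight $\boldsymbol{w}$ Padé approximant of $\boldsymbol{f}$ if (i) $(P_1,\ldots,P_q)\ne(0,\ldots,0)$; (ii) $\deg P_j\le w_j$ for all $j$; (iii) ${\rm ord}\big(\sum_{j=1}^qP_jf_j\big)\ge\sum_{j=1}^q(w_j+1)-1$. Families indexed by pairs $(i,j_i)$ are ordered lexicographically. Here $\log(1+z)=\sum_{k\ge1}(-1)^{k-1}z^k/k$ and $(1+z)^{\omega}=\sum_{k\ge0}\binom{\omega}{k}z^k$ in $K[[z]]$. *)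

theory Defs
  imports "HOL-Computational_Algebra.Computational_Algebra" "HOL-Library.Extended_Nat"
begin

(* subdegree is 0 at the zero series, whereas ord 0 = \<infinity>. *)
definition fps_ord :: "'a::zero fps \<Rightarrow> enat" where
  "fps_ord f = (if f = 0 then \<infinity> else enat (subdegree f))"

(* The q-tuples are lists of common length q. The truncated subtraction in the last conjunct is
   exact: q = 0 is excluded by the second conjunct. *)
definition pade_approximant :: "nat list \<Rightarrow> 'a::field fps list \<Rightarrow> 'a poly list \<Rightarrow> bool" where
  "pade_approximant ws fs Ps \<longleftrightarrow>
     length ws = length fs \<and> length Ps = length fs \<and>
     (\<exists>j<length fs. Ps ! j \<noteq> 0) \<and>
     (\<forall>j<length fs. degree (Ps ! j) \<le> ws ! j) \<and>
     fps_ord (\<Sum>j<length fs. fps_of_poly (Ps ! j) * fs ! j)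
       \<ge> enat ((\<Sum>j<length fs. ws ! j + 1) - 1)"

(* The family (g i j) with 1 \<le> i \<le> m and 0 \<le> j < r i, listed lexicographically in (i, j). *)
definition lex_family :: "nat \<Rightarrow> (nat \<Rightarrow> nat) \<Rightarrow> (nat \<Rightarrow> nat \<Rightarrow> 'b) \<Rightarrow> 'b list" where
  "lex_family m r g = concat (map (\<lambda>i. map (g i) [0..<r i]) [1..<Suc m])"

(* x - a in K(x), the fraction field of K[x] *)
definition lin :: "'a::field \<Rightarrow> 'a poly fract" where
  "lin a = to_fract [:- a, 1:]"

(* F_k for k = r_1 + ... + r_u + s *)
definition F_rat ::
  "nat \<Rightarrow> (nat \<Rightarrow> nat) \<Rightarrow> (nat \<Rightarrow> 'a::field) \<Rightarrow> nat \<Rightarrow> nat \<Rightarrow> nat \<Rightarrow> 'a poly fract" where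
  "F_rat m r \<omega> n u s =
     1 / (\<Prod>i=1..u. \<Prod>h=0..n+1. lin (\<omega> i + of_nat h) ^ r i)
   * (1 / lin (\<omega> (u+1) + of_nat (n+1)) ^ s)
   * (1 / (\<Prod>i=u+1..m. \<Prod>h=0..n. lin (\<omega> i + of_nat h) ^ r i))"

definition P_poly ::
  "nat \<Rightarrow> (nat \<Rightarrow> nat \<Rightarrow> nat \<Rightarrow> 'a::field_char_0) \<Rightarrow> nat \<Rightarrow> nat \<Rightarrow> 'a poly" where
  "P_poly n p i j = (\<Sum>h=0..n+1. smult (p h i (j+1) / fact j) ([:1, 1:] ^ h))"

end

theory Submission
  imports Defs
begin

text \<open>
  A Laurent series \<open>\<xi>\<close> that is not constant is transcendental over \<open>K\<close>, so \<open>x \<mapsto> \<xi>\<close> embeds \<open>K(x)\<close>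
  into the Laurent series, and both sides of the partial fraction identity for \<open>F\<^sub>k\<close> can be expanded.
  For \<open>\<xi> = 1/t\<close> this is the expansion at infinity: since the denominator of \<open>F\<^sub>k\<close> has degree
  \<open>D = \<Sum>(w\<^sub>j + 1)\<close>, all coefficients below \<open>t\<^sup>D\<close> vanish. As \<open>1/(x - a)\<^sup>j\<^sup>+\<^sup>1\<close> is the Borel-Laplace
  transform of \<open>e\<^sup>a\<^sup>t t\<^sup>j / j!\<close>, the exponential sum \<open>\<Sum> p / j! \<cdot> e\<^sup>a\<^sup>t t\<^sup>j\<close> has order at least \<open>D - 1\<close>, and
  substituting \<open>t = log(1 + z)\<close> gives the order condition. For \<open>\<xi> = b + t\<close> with
  \<open>b = \<omega>\<^sub>i + n + 1\<close> it is the expansion at a possible pole, whose order bounds the degrees of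
  the polynomials.
\<close>

section \<open>Evaluation of polynomials and rational functions at a Laurent series\<close>

definition fls_poly :: "'a::field_char_0 fls \<Rightarrow> 'a poly \<Rightarrow> 'a fls" where
  "fls_poly \<xi> p = poly (map_poly fls_const p) \<xi>"

lemma fls_poly_0 [simp]: "fls_poly \<xi> 0 = 0"
  by (simp add: fls_poly_def)

lemma fls_poly_pCons [simp]: "fls_poly \<xi> (pCons c p) = fls_const c + \<xi> * fls_poly \<xi> p"
  by (simp add: fls_poly_def map_poly_pCons)

lemma fls_poly_1 [simp]: "fls_poly \<xi> 1 = 1"
  by (simp add: fls_poly_def)

lemma fls_poly_add: "fls_poly \<xi> (p + q) = fls_poly \<xi> p + fls_poly \<xi> q"
  by (induction p q rule: poly_induct2) (simp_all add: algebra_simps flip: fls_plus_const)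

lemma fls_poly_smult: "fls_poly \<xi> (smult c p) = fls_const c * fls_poly \<xi> p"
  by (induction p) (simp_all add: algebra_simps flip: fls_const_mult_const)

lemma fls_poly_mult: "fls_poly \<xi> (p * q) = fls_poly \<xi> p * fls_poly \<xi> q"
  by (induction p) (simp_all add: fls_poly_add fls_poly_smult algebra_simps)

lemma fls_deriv_fls_poly: "fls_deriv (fls_poly \<xi> p) = fls_poly \<xi> (pderiv p) * fls_deriv \<xi>"
  by (induction p) (simp_all add: pderiv_pCons fls_poly_add algebra_simps)

text \<open>An algebraic relation for \<open>\<xi>\<close> of least positive degree would yield a smaller one by
  differentiation.\<close>
lemma fls_poly_eq_0_iff:
  assumes "fls_deriv \<xi> \<noteq> 0"
  shows "fls_poly \<xi> p = 0 \<longleftrightarrow> p = 0"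
proof
  show "fls_poly \<xi> p = 0 \<Longrightarrow> p = 0"
  proof (induction "degree p" arbitrary: p rule: less_induct)
    case less
    show ?case
    proof (cases "degree p = 0")
      case True
      then obtain c where "p = [:c:]"
        by (rule degree_eq_zeroE)
      with less.prems show ?thesis by simp
    next
      case False
      have "fls_poly \<xi> (pderiv p) = 0"
        using fls_deriv_fls_poly[of \<xi> p] less.prems assms by simp
      moreover have "degree (pderiv p) < degree p"
        using False by (simp add: degree_pderiv)
      ultimately have "pderiv p = 0"
        using less.hyps by blast
      with False show ?thesis by (simp add: pderiv_eq_0_iff)
    qed
  qed
qed simp

text \<open>The choice operator is used because the quotient may depend on the representation when
  \<open>\<xi>\<close> is constant: if \<open>\<xi> = c\<close>, then
  \<open>(x - c) / (x - c)\<close> would evaluate to \<open>0 / 0 = 0\<close>.\<close>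

definition fls_fract :: "'a::field_char_0 fls \<Rightarrow> 'a poly fract \<Rightarrow> 'a fls" where
  "fls_fract \<xi> x = (SOME v. \<exists>p q. q \<noteq> 0 \<and> x = Fract p q \<and> v = fls_poly \<xi> p / fls_poly \<xi> q)"

context
  fixes \<xi> :: "'a::field_char_0 fls"
  assumes deriv: "fls_deriv \<xi> \<noteq> 0"
begin

text \<open>Equal fractions have equal cross products, and transcendence of \<open>\<xi>\<close>
  keeps the denominators nonzero, so the chosen value is independent of the representative.\<close>

lemma fls_fract_Fract:
  assumes "q \<noteq> 0"
  shows "fls_fract \<xi> (Fract p q) = fls_poly \<xi> p / fls_poly \<xi> q"
  unfolding fls_fract_def
proof (rule some_equality)
  fix v
  assume "\<exists>p' q'. q' \<noteq> 0 \<and> Fract p q = Fract p' q' \<and> v = fls_poly \<xi> p' / fls_poly \<xi> q'"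
  then obtain p' q' where *: "q' \<noteq> 0" "Fract p q = Fract p' q'"
    and v: "v = fls_poly \<xi> p' / fls_poly \<xi> q'"
    by blast
  have "p * q' = p' * q"
    using * assms by (simp add: eq_fract)
  then have "fls_poly \<xi> p * fls_poly \<xi> q' = fls_poly \<xi> p' * fls_poly \<xi> q"
    by (metis fls_poly_mult)
  then show "v = fls_poly \<xi> p / fls_poly \<xi> q"
    using * assms by (simp add: v fls_poly_eq_0_iff[OF deriv] frac_eq_eq)
qed (use assms in blast)

lemma fls_fract_to_fract: "fls_fract \<xi> (to_fract p) = fls_poly \<xi> p"
  by (simp add: to_fract_def fls_fract_Fract)

lemma fls_fract_add: "fls_fract \<xi> (x + y) = fls_fract \<xi> x + fls_fract \<xi> y"
  by (cases x; cases y)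
     (simp add: fls_fract_Fract fls_poly_add fls_poly_mult fls_poly_eq_0_iff[OF deriv] add_frac_eq)

lemma fls_fract_mult: "fls_fract \<xi> (x * y) = fls_fract \<xi> x * fls_fract \<xi> y"
  by (cases x; cases y) (simp add: fls_fract_Fract fls_poly_mult)

lemma fls_fract_0: "fls_fract \<xi> 0 = 0" and fls_fract_1: "fls_fract \<xi> 1 = 1"
  using fls_fract_to_fract[of 0] fls_fract_to_fract[of 1] by simp_all

lemma fls_fract_inverse: "fls_fract \<xi> (inverse x) = inverse (fls_fract \<xi> x)"
proof (cases "x = 0")
  case False
  then have "fls_fract \<xi> x * fls_fract \<xi> (inverse x) = 1"
    by (simp add: fls_fract_1 flip: fls_fract_mult)
  then show ?thesis by (metis inverse_unique)
qed (simp add: fls_fract_0)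

lemma fls_fract_power: "fls_fract \<xi> (x ^ n) = fls_fract \<xi> x ^ n"
  by (induction n) (simp_all add: fls_fract_1 fls_fract_mult)

lemma fls_fract_sum: "fls_fract \<xi> (\<Sum>x\<in>A. f x) = (\<Sum>x\<in>A. fls_fract \<xi> (f x))"
  by (induction A rule: infinite_finite_induct) (simp_all add: fls_fract_0 fls_fract_add)

lemma fls_fract_prod: "fls_fract \<xi> (\<Prod>x\<in>A. f x) = (\<Prod>x\<in>A. fls_fract \<xi> (f x))"
  by (induction A rule: infinite_finite_induct) (simp_all add: fls_fract_1 fls_fract_mult)

lemma fls_fract_lin: "fls_fract \<xi> (lin a) = \<xi> - fls_const a"
  by (simp add: lin_def fls_fract_to_fract)

lemma fls_fract_F_rat:
  "fls_fract \<xi> (F_rat m r \<omega> n u s) =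
     (\<Prod>i=1..u. \<Prod>h=0..n+1. inverse (\<xi> - fls_const (\<omega> i + of_nat h)) ^ r i) *
     inverse (\<xi> - fls_const (\<omega> (u+1) + of_nat (n+1))) ^ s *
     (\<Prod>i=u+1..m. \<Prod>h=0..n. inverse (\<xi> - fls_const (\<omega> i + of_nat h)) ^ r i)"
  unfolding F_rat_def
  by (simp only: divide_inverse mult_1 fls_fract_mult fls_fract_inverse fls_fract_prod
        fls_fract_power fls_fract_lin)
     (simp only: power_inverse o_def flip: prod_inversef)

lemma fls_fract_partial_fractions:
  "fls_fract \<xi> (\<Sum>i=1..m. \<Sum>h=0..n+1. \<Sum>j=1..r i. to_fract [:p h i j:] / lin (\<omega> i + of_nat h) ^ j) =
     (\<Sum>i=1..m. \<Sum>h=0..n+1. \<Sum>j=1..r i.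
       fls_const (p h i j) * inverse (\<xi> - fls_const (\<omega> i + of_nat h)) ^ j)"
  by (simp only: fls_fract_sum fls_fract_mult fls_fract_inverse fls_fract_power fls_fract_lin
        fls_fract_to_fract divide_inverse power_inverse) simp

end

section \<open>Expansion at infinity and its Borel transform\<close>

lemma fps_to_fls_sum: "fps_to_fls (\<Sum>x\<in>A. f x) = (\<Sum>x\<in>A. fps_to_fls (f x))"
  by (induction A rule: infinite_finite_induct) simp_all

lemma fps_to_fls_prod: "fps_to_fls (\<Prod>x\<in>A. f x) = (\<Prod>x\<in>A. fps_to_fls (f x))"
  by (induction A rule: infinite_finite_induct) (simp_all add: fls_times_fps_to_fls)

text \<open>\<open>1/(x - a)\<close> expanded in \<open>t = 1/x\<close>.\<close>
definition recip_at_infinity :: "'a::field_char_0 \<Rightarrow> 'a fps" where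
  "recip_at_infinity a = fps_X * inverse (1 - fps_const a * fps_X)"

lemma fps_to_fls_recip_at_infinity:
  "fps_to_fls (recip_at_infinity a) = inverse (fls_X_inv - fls_const a)"
proof -
  have "fps_to_fls (recip_at_infinity a) * (fls_X_inv - fls_const a) =
      fps_to_fls (inverse (1 - fps_const a * fps_X)) *
      (fls_X * fls_X_inv - fls_const a * fls_X)"
    by (simp add: recip_at_infinity_def fls_times_fps_to_fls algebra_simps)
  also have "fls_X * fls_X_inv - fls_const a * fls_X = fps_to_fls (1 - fps_const a * fps_X)"
    by (simp add: fls_times_fps_to_fls flip: fls_inverse_X)
  also have "fps_to_fls (inverse (1 - fps_const a * fps_X)) * \<dots> = 1"
    by (simp only: flip: fls_times_fps_to_fls) (simp add: inverse_mult_eq_1)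
  finally show ?thesis
    by (metis inverse_unique mult.commute)
qed

text \<open>Negative binomial series. The exponents are taken as successors because the pole of
  order \<open>j + 1\<close> corresponds to \<open>t^j\<close> and the coefficient at
  \<open>N + 1\<close> to the one at \<open>N\<close> under the Borel transform.\<close>

lemma recip_at_infinity_power_nth:
  "(recip_at_infinity a ^ Suc j) $ Suc N = (if j \<le> N then of_nat (N choose j) * a ^ (N - j) else 0)"
proof -
  have "inverse (1 - fps_const a * fps_X) ^ Suc j = Abs_fps (\<lambda>k. of_nat ((j + k) choose k) * a ^ k)"
    using one_minus_const_fps_X_neg_power'[of "Suc j" a]
    by (simp add: fps_inverse_power del: power_Suc)
  then have "recip_at_infinity a ^ Suc j =
      fps_X ^ Suc j * Abs_fps (\<lambda>k. of_nat ((j + k) choose k) * a ^ k)"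
    by (simp only: recip_at_infinity_def power_mult_distrib)
  then show ?thesis
    by (simp add: fps_X_power_mult_nth binomial_symmetric[of j N] del: power_Suc)
qed

text \<open>The Borel transform of a single pole: it lowers the index by one and divides by
  \<open>fact N\<close>. The identity rests on
  \<open>(N choose j) / N! = 1 / (j! (N - j)!)\<close>.\<close>

lemma fps_exp_times_X_power_nth:
  "(fps_const (c / fact j) * fps_exp a * fps_X ^ j) $ N =
     c * (recip_at_infinity a ^ Suc j) $ Suc N / fact N"
  unfolding recip_at_infinity_power_nth
  by (simp add: fps_X_power_mult_right_nth mult.assoc binomial_fact)

text \<open>Both sides solve \<open>(1 + z) y' = a y\<close> with \<open>y(0) = 1\<close>, which
  determines the series.\<close>

lemma fps_exp_compose_ln: "fps_exp a oo fps_ln 1 = fps_binomial a"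
  by (subst fps_binomial_ODE_unique' [symmetric])
     (simp add: fps_compose_deriv fps_ln_deriv fps_compose_mult_distrib fps_divide_unit
       mult.assoc)

section \<open>Orders of power series as divisibility by powers of the variable\<close>

lemma fps_X_power_dvdI:
  assumes "\<And>i. i < n \<Longrightarrow> f $ i = (0 :: 'a :: field)"
  shows "fps_X ^ n dvd f"
  using assms by (cases "f = 0") (auto simp: fps_dvd_iff intro: subdegree_geI)

lemma fps_X_power_dvdD:
  assumes "fps_X ^ n dvd (f :: 'a :: field fps)" "i < n"
  shows "f $ i = 0"
  using assms by (auto simp: fps_X_power_mult_nth elim!: dvdE)

lemma fps_X_power_dvd_compose:
  assumes "fps_X ^ n dvd (f :: 'a :: field fps)" "g $ 0 = 0"
  shows "fps_X ^ n dvd f oo g"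
proof -
  obtain h where "f = fps_X ^ n * h"
    using assms(1) by (rule dvdE)
  then have "f oo g = g ^ n * (h oo g)"
    using assms(2) by (simp add: fps_compose_mult_distrib fps_compose_power[symmetric])
  moreover have "fps_X dvd g"
    using assms(2) fps_X_power_dvdI[of 1 g] by simp
  ultimately show ?thesis
    by (metis dvd_mult2 dvd_power_same)
qed

lemma enat_le_fps_ord:
  assumes "fps_X ^ n dvd (f :: 'a :: field fps)"
  shows "enat n \<le> fps_ord f"
  using assms by (auto simp: fps_ord_def fps_dvd_iff)

lemma fps_X_power_sum_dvd_prod:
  assumes "\<And>a. fps_X dvd (g a :: 'a :: field fps)"
  shows "fps_X ^ (\<Sum>i\<in>A. Suc N * r i) dvd (\<Prod>i\<in>A. \<Prod>h=0..N. g (c i h) ^ r i)"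
proof -
  have "(\<Prod>i\<in>A. \<Prod>h=0..N. fps_X ^ r i) dvd (\<Prod>i\<in>A. \<Prod>h=0..N. g (c i h) ^ r i)"
    by (intro prod_dvd_prod dvd_power_same assms)
  moreover have "(\<Prod>i\<in>A. \<Prod>h=0..N. fps_X ^ r i :: 'a fps) = fps_X ^ (\<Sum>i\<in>A. Suc N * r i)"
    by (simp add: power_sum power_add mult.commute flip: power_mult)
  ultimately show ?thesis by simp
qed

text \<open>Each linear factor of the denominator contributes one factor \<open>t\<close> at
  infinity, so the product form has order at least the degree of the denominator. The coefficients
  of the partial fraction form below that degree must vanish too.\<close>

lemma partial_fractions_moment:
  assumes "F_rat m r \<omega> n u s =
      (\<Sum>i=1..m. \<Sum>h=0..n+1. \<Sum>j=1..r i. to_fract [:p h i j:] / lin (\<omega> i + of_nat h) ^ j)"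
    and "N < (\<Sum>i=1..u. Suc (n+1) * r i) + s + (\<Sum>i=u+1..m. Suc n * r i)"
  shows "(\<Sum>i=1..m. \<Sum>h=0..n+1. \<Sum>j=1..r i.
      p h i j * (recip_at_infinity (\<omega> i + of_nat h) ^ j) $ N) = 0"
proof -
  let ?g = recip_at_infinity
  let ?F = "(\<Prod>i=1..u. \<Prod>h=0..n+1. ?g (\<omega> i + of_nat h) ^ r i) * ?g (\<omega> (u+1) + of_nat (n+1)) ^ s *
    (\<Prod>i=u+1..m. \<Prod>h=0..n. ?g (\<omega> i + of_nat h) ^ r i)"
  let ?S = "\<Sum>i=1..m. \<Sum>h=0..n+1. \<Sum>j=1..r i. fps_const (p h i j) * ?g (\<omega> i + of_nat h) ^ j"
  have deriv: "fls_deriv fls_X_inv \<noteq> (0 :: 'a fls)"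
    by simp
  have "fps_to_fls ?F = fls_fract fls_X_inv (F_rat m r \<omega> n u s)"
    by (simp only: fls_fract_F_rat[OF deriv] fls_times_fps_to_fls fps_to_fls_prod fps_to_fls_power
        fps_to_fls_recip_at_infinity)
  also have "\<dots> = fps_to_fls ?S"
    by (simp only: assms(1) fls_fract_partial_fractions[OF deriv] fls_times_fps_to_fls
        fps_to_fls_sum fps_to_fls_power fps_to_fls_recip_at_infinity fps_const_to_fls)
  finally have F_eq: "?F = ?S"
    by (simp only: fps_to_fls_eq_iff)
  have X: "fps_X dvd ?g a" for a :: 'a
    by (simp add: recip_at_infinity_def)
  have dvd: "fps_X ^ ((\<Sum>i=1..u. Suc (n+1) * r i) + s + (\<Sum>i=u+1..m. Suc n * r i)) dvd ?F"
    unfolding power_add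
    by (intro mult_dvd_mono dvd_power_same fps_X_power_sum_dvd_prod X)
  have "?S $ N = 0"
    using fps_X_power_dvdD[OF dvd assms(2)] unfolding F_eq .
  then show ?thesis
    by (simp only: fps_sum_nth fps_mult_left_const_nth)
qed

text \<open>The remainder \<open>\<Sum> P f\<close> in the variable \<open>t = log(1 + z)\<close>.
  The sum over \<open>h\<close> is innermost so that it can be collected into one polynomial per
  pair \<open>(i, j)\<close>.\<close>

definition exp_sum :: "nat \<Rightarrow> (nat \<Rightarrow> nat) \<Rightarrow> (nat \<Rightarrow> 'a) \<Rightarrow> nat \<Rightarrow> (nat \<Rightarrow> nat \<Rightarrow> nat \<Rightarrow> 'a) \<Rightarrow>
    'a::field_char_0 fps" where
  "exp_sum m r \<omega> n p = (\<Sum>i=1..m. \<Sum>j<r i. \<Sum>h=0..n+1.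
     fps_const (p h i (j+1) / fact j) * fps_exp (\<omega> i + of_nat h) * fps_X ^ j)"

lemma exp_sum_nth:
  "exp_sum m r \<omega> n p $ N =
     (\<Sum>i=1..m. \<Sum>h=0..n+1. \<Sum>j=1..r i.
       p h i j * (recip_at_infinity (\<omega> i + of_nat h) ^ j) $ Suc N) / fact N"
proof -
  let ?f = "\<lambda>i h j. p h i j * (recip_at_infinity (\<omega> i + of_nat h) ^ j) $ Suc N / fact N"
  have "exp_sum m r \<omega> n p $ N = (\<Sum>i=1..m. \<Sum>j<r i. \<Sum>h=0..n+1. ?f i h (Suc j))"
    by (simp only: exp_sum_def fps_sum_nth fps_exp_times_X_power_nth Suc_eq_plus1)
  also have "\<dots> = (\<Sum>i=1..m. \<Sum>h=0..n+1. \<Sum>j<r i. ?f i h (Suc j))"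
    by (intro sum.cong refl sum.swap)
  also have "\<dots> = (\<Sum>i=1..m. \<Sum>h=0..n+1. \<Sum>j=1..r i. ?f i h j)"
    by (intro sum.cong refl sum.reindex_bij_witness[of _ "\<lambda>j. j - 1" Suc]) auto
  finally show ?thesis
    by (simp only: sum_divide_distrib)
qed

text \<open>Since \<open>exp((\<omega> + h) log(1 + z)) = (1 + z)^\<omega> (1 + z)^h\<close>, the
  shifts \<open>h\<close> turn into polynomial factors.\<close>

lemma exp_sum_compose_ln:
  "exp_sum m r \<omega> n p oo fps_ln 1 =
     (\<Sum>i=1..m. \<Sum>j<r i. fps_of_poly (P_poly n p i j) * (fps_binomial (\<omega> i) * fps_ln 1 ^ j))"
proof -
  have "(fps_const c * fps_exp (\<omega> i + of_nat h) * fps_X ^ j) oo fps_ln 1 =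
      fps_of_poly (smult c ([:1, 1:] ^ h)) * (fps_binomial (\<omega> i) * fps_ln 1 ^ j)" for c i h j
    by (simp add: fps_compose_mult_distrib fps_exp_compose_ln fps_binomial_add_mult
        fps_binomial_of_nat fps_of_poly_smult fps_of_poly_power fps_of_poly_pCons algebra_simps
        flip: fps_compose_power)
  then show ?thesis
    by (simp only: exp_sum_def P_poly_def fps_compose_sum_distrib fps_of_poly_sum sum_distrib_right)
qed

section \<open>Nonvanishing and degrees of the polynomials\<close>

lemma F_rat_nonzero: "F_rat m r \<omega> n u s \<noteq> 0"
  by (simp add: F_rat_def lin_def)

text \<open>Linear independence of the powers of \<open>1 + z\<close>: they are the images of the
  monomials under the injective substitution \<open>z \<mapsto> 1 + z\<close>.\<close>

lemma sum_smult_linear_power_eq_0D: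
  assumes "(\<Sum>h=0..n. smult (c h) ([:1, 1:] ^ h)) = (0 :: 'a :: field poly)" "h \<le> n"
  shows "c h = 0"
proof -
  let ?q = "\<Sum>h=0..n. monom (c h) h"
  have power: "pcompose ([:0, 1:] ^ h) [:1, 1:] = ([:1, 1:] ^ h :: 'a poly)" for h
    by (induction h) (simp_all add: pcompose_1 pcompose_mult pcompose_pCons)
  have "pcompose ?q [:1, 1:] = (\<Sum>h=0..n. smult (c h) ([:1, 1:] ^ h))"
    by (simp add: pcompose_sum monom_altdef pcompose_smult power)
  with assms have "?q = 0"
    by (simp add: pcompose_eq_0_iff)
  then have "coeff ?q h = 0" by simp
  with assms(2) show ?thesis by (simp add: coeff_sum)
qed

lemma degree_P_poly_le: "degree (P_poly n p i j) \<le> n + 1"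
  unfolding P_poly_def
  by (intro degree_sum_le) (auto intro!: order.trans[OF degree_smult_le] simp: degree_linear_power)

lemma degree_P_poly_le':
  assumes "p (n+1) i (j+1) = 0"
  shows "degree (P_poly n p i j) \<le> n"
proof -
  have "P_poly n p i j = (\<Sum>h=0..n. smult (p h i (j+1) / fact j) ([:1, 1:] ^ h))"
    using assms by (simp add: P_poly_def)
  then show ?thesis
    by (auto intro!: degree_sum_le order.trans[OF degree_smult_le] simp: degree_linear_power)
qed

section \<open>Lexicographic indexing by pairs\<close>

lemma lex_family_Suc: "lex_family (Suc m) r g = lex_family m r g @ map (g (Suc m)) [0..<r (Suc m)]"
  by (simp add: lex_family_def)

lemma lex_family_0: "lex_family 0 r g = []"
  by (simp add: lex_family_def)

text \<open>Reduces every family to the one list of index pairs, so that positions in different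
  families can be compared.\<close>

lemma lex_family_conv_map: "lex_family m r g = map (\<lambda>(i, j). g i j) (lex_family m r Pair)"
  by (induction m) (simp_all add: lex_family_0 lex_family_Suc)

lemma length_lex_family: "length (lex_family m r g) = (\<Sum>i=1..m. r i)"
  by (induction m) (simp_all add: lex_family_0 lex_family_Suc)

lemma set_lex_family: "set (lex_family m r Pair) = {(i, j). 1 \<le> i \<and> i \<le> m \<and> j < r i}"
  by (auto simp: lex_family_def)

lemma sum_lex_family:
  "(\<Sum>l<(\<Sum>i=1..m. r i). f (lex_family m r Pair ! l)) = (\<Sum>i=1..m. \<Sum>j<r i. f (i, j))"
proof -
  have "(\<Sum>l<(\<Sum>i=1..m. r i). f (lex_family m r Pair ! l)) = sum_list (map f (lex_family m r Pair))"
    by (simp add: sum_list_sum_nth length_lex_family atLeast0LessThan)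
  also have "\<dots> = (\<Sum>i=1..m. \<Sum>j<r i. f (i, j))"
    by (induction m)
       (simp_all add: lex_family_0 lex_family_Suc interv_sum_list_conv_sum_set_nat o_def
          atLeast0LessThan)
  finally show ?thesis .
qed

lemma lex_family_nth_ge:
  assumes "u < m" "s \<le> r (u+1)" "(\<Sum>i=1..u. r i) + s \<le> l" "l < (\<Sum>i=1..m. r i)"
    and "lex_family m r Pair ! l = (i, j)"
  shows "u + 1 \<le> i" "i \<le> m" "j < r i" "i = u + 1 \<Longrightarrow> s \<le> j"
proof -
  \<comment> \<open>\<open>T\<close> is what remains of the index list after the first
    \<open>u\<close> blocks and the first \<open>s\<close> entries of block
    \<open>u + 1\<close>.\<close>
  define T where "T = map (Pair (u+1)) [s..<r (u+1)] @ concat (map (\<lambda>i. map (Pair i) [0..<r i]) [u+2..<Suc m])"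
  have "[1..<Suc m] = [1..<Suc u] @ [u+1] @ [u+2..<Suc m]"
    using assms(1) upt_add_eq_append[of 1 "Suc u" "m - u"] by (simp add: upt_conv_Cons)
  moreover have "[0..<r (u+1)] = [0..<s] @ [s..<r (u+1)]"
    using assms(2) by (metis le_add_diff_inverse upt_add_eq_append zero_le)
  ultimately have "lex_family m r Pair = (lex_family u r Pair @ map (Pair (u+1)) [0..<s]) @ T"
    by (simp only: lex_family_def T_def map_append concat_append list.map concat.simps append_assoc append_Nil append_Nil2)
  moreover have "length (lex_family u r Pair @ map (Pair (u+1)) [0..<s]) = (\<Sum>i=1..u. r i) + s"
    by (simp add: length_lex_family)
  ultimately have "(i, j) \<in> set T"
    using assms(3-5) length_lex_family[of m r Pair]
    by (metis append_same_eq length_append nth_append not_less nth_mem add_less_cancel_left le_add_diff_inverse)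
  then show "u + 1 \<le> i" "i \<le> m" "j < r i" "i = u + 1 \<Longrightarrow> s \<le> j"
    using assms(1) by (auto simp: T_def)
qed

section \<open>Expansion at a possible pole; regular series are those in the range of
  \<open>fps_to_fls\<close>\<close>

lemma range_fps_to_fls_closed:
  shows "x \<in> range fps_to_fls \<Longrightarrow> y \<in> range fps_to_fls \<Longrightarrow> x * y \<in> range (fps_to_fls :: 'a::field fps \<Rightarrow> _)"
    and "x \<in> range fps_to_fls \<Longrightarrow> x ^ k \<in> range (fps_to_fls :: 'a::field fps \<Rightarrow> _)"
    and "(\<And>i. i \<in> A \<Longrightarrow> f i \<in> range fps_to_fls) \<Longrightarrow> prod f A \<in> range (fps_to_fls :: 'a::field fps \<Rightarrow> _)"
proof -
  show mult: "x * y \<in> range fps_to_fls" if "x \<in> range fps_to_fls" "y \<in> range fps_to_fls"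
    for x y :: "'a fls"
    using that by (auto simp flip: fls_times_fps_to_fls)
  show "x ^ k \<in> range fps_to_fls" if "x \<in> range fps_to_fls" for x :: "'a fls"
    using that by (auto simp flip: fps_to_fls_power)
  show "prod f A \<in> range fps_to_fls" if "\<And>i. i \<in> A \<Longrightarrow> f i \<in> range fps_to_fls"
    for f :: "_ \<Rightarrow> 'a fls"
    using that
    by (induction A rule: infinite_finite_induct) (auto intro: mult range_eqI[of _ _ 1])
qed

text \<open>At \<open>x = b + t\<close> the factor \<open>x - a\<close> has constant term
  \<open>b - a\<close>, which is nonzero, so it is a unit among the power series.\<close>

lemma inverse_shifted_lin_in_range:
  assumes "a \<noteq> (b :: 'a :: field)"
  shows "inverse (fls_X + fls_const b - fls_const a) \<in> range fps_to_fls"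
proof -
  have "fls_X + fls_const b - fls_const a = fps_to_fls (fps_X + fps_const (b - a))"
    by (simp add: fls_minus_const)
  moreover have "subdegree (fps_X + fps_const (b - a)) = 0"
    using assms by (intro subdegree_eq_0) simp
  ultimately show ?thesis
    by (metis fls_inverse_fps_to_fls rangeI)
qed

text \<open>At \<open>b = \<omega> i0 + n + 1\<close> the pole of \<open>F_rat\<close> has order at
  most \<open>s\<close> if \<open>i0 = u + 1\<close>, and there is none otherwise. The coefficient
  sought belongs to a pole of order \<open>j0 + 1\<close>, which exceeds this.\<close>

lemma partial_fractions_pole_bound:
  fixes \<omega> :: "nat \<Rightarrow> 'a::field_char_0"
  assumes inj: "\<And>i h. 1 \<le> i \<Longrightarrow> i \<le> m \<Longrightarrow> h \<le> n + 1 \<Longrightarrow> \<omega> i + of_nat h = \<omega> i0 + of_nat (n+1) \<Longrightarrow>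
      i = i0 \<and> h = n + 1"
    and i0: "u + 1 \<le> i0" "i0 \<le> m" and "u < m"
    and j0: "j0 < r i0" "i0 = u + 1 \<Longrightarrow> s \<le> j0"
    and F: "F_rat m r \<omega> n u s =
      (\<Sum>i=1..m. \<Sum>h=0..n+1. \<Sum>j=1..r i. to_fract [:p h i j:] / lin (\<omega> i + of_nat h) ^ j)"
  shows "p (n+1) i0 (j0+1) = 0"
proof -
  define b where "b = \<omega> i0 + of_nat (n+1)"
  define G where "G a = inverse (fls_X + fls_const b - fls_const a)" for a
  let ?R = "range (fps_to_fls :: 'a fps \<Rightarrow> 'a fls)"
  have deriv: "fls_deriv (fls_X + fls_const b) \<noteq> (0 :: 'a fls)"
    by simp
  have G_b: "G b = fls_X_inv"
    by (simp add: G_def fls_inverse_X)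
  have G_R: "G (\<omega> i + of_nat h) \<in> ?R"
    if "1 \<le> i" "i \<le> m" "h \<le> n + 1" "i \<noteq> i0 \<or> h \<noteq> n + 1" for i h
    using that inj unfolding G_def b_def by (intro inverse_shifted_lin_in_range) blast
  have neg: "fls_nth x k = 0" if "x \<in> ?R" "k < 0" for x and k :: int
    using that by auto
  \<comment> \<open>The first product has \<open>i \<le> u < i0\<close> and the third has
    \<open>h \<le> n\<close>, so neither contains the factor that vanishes at
    \<open>b\<close>.\<close>
  have A: "(\<Prod>i=1..u. \<Prod>h=0..n+1. G (\<omega> i + of_nat h) ^ r i) \<in> ?R"
    by (intro range_fps_to_fls_closed G_R) (use i0 in auto)
  have C: "(\<Prod>i=u+1..m. \<Prod>h=0..n. G (\<omega> i + of_nat h) ^ r i) \<in> ?R"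
    by (intro range_fps_to_fls_closed G_R) auto
  let ?F = "(\<Prod>i=1..u. \<Prod>h=0..n+1. G (\<omega> i + of_nat h) ^ r i) * G (\<omega> (u+1) + of_nat (n+1)) ^ s *
    (\<Prod>i=u+1..m. \<Prod>h=0..n. G (\<omega> i + of_nat h) ^ r i)"
  let ?k = "- int (j0 + 1)"
  have F_nth: "fls_nth ?F ?k = 0"
  proof (cases "i0 = u + 1")
    case True
    obtain f where f: "(\<Prod>i=1..u. \<Prod>h=0..n+1. G (\<omega> i + of_nat h) ^ r i) *
        (\<Prod>i=u+1..m. \<Prod>h=0..n. G (\<omega> i + of_nat h) ^ r i) = fps_to_fls f"
      using range_fps_to_fls_closed(1)[OF A C] by auto
    have "G (\<omega> (u+1) + of_nat (n+1)) = fls_X_inv"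
      using G_b True unfolding b_def by simp
    then have "?F = fls_X_inv ^ s * fps_to_fls f"
      by (simp only: mult_ac flip: f)
    then show ?thesis
      using j0(2)[OF True] by (simp add: fls_X_inv_power_times_conv_shift)
  next
    case False
    then have "G (\<omega> (u+1) + of_nat (n+1)) ^ s \<in> ?R"
      using \<open>u < m\<close> by (intro range_fps_to_fls_closed G_R) auto
    then show ?thesis
      using A C by (intro neg range_fps_to_fls_closed(1)) auto
  qed
  have F_eq: "?F = (\<Sum>i=1..m. \<Sum>h=0..n+1. \<Sum>j=1..r i. fls_const (p h i j) * G (\<omega> i + of_nat h) ^ j)"
    unfolding G_def fls_fract_F_rat[OF deriv, symmetric] F
    by (rule fls_fract_partial_fractions[OF deriv])
  have "0 = (\<Sum>i=1..m. \<Sum>h=0..n+1. \<Sum>j=1..r i. p h i j * fls_nth (G (\<omega> i + of_nat h) ^ j) ?k)"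
    using F_nth unfolding F_eq by (simp only: fls_nth_sum fls_mult_const_nth)
  \<comment> \<open>Terms centred away from \<open>b\<close> are regular and have no negative
    coefficients; those centred at \<open>b\<close> are pure powers \<open>t^(-j)\<close>, so only
    \<open>j = j0 + 1\<close> contributes.\<close>
  also have "\<dots> = (\<Sum>i=1..m. \<Sum>h=0..n+1. \<Sum>j=1..r i.
      if j = j0 + 1 then if h = n + 1 then if i = i0 then p h i j else 0 else 0 else 0)"
  proof (intro sum.cong refl)
    fix i h j assume ih: "i \<in> {1..m}" "h \<in> {0..n+1}" "j \<in> {1..r i}"
    show "p h i j * fls_nth (G (\<omega> i + of_nat h) ^ j) ?k =
      (if j = j0 + 1 then if h = n + 1 then if i = i0 then p h i j else 0 else 0 else 0)"
    proof (cases "i = i0 \<and> h = n + 1")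
      case True
      then have "G (\<omega> i + of_nat h) = fls_X_inv"
        using G_b unfolding b_def by simp
      with True show ?thesis by auto
    next
      case False
      with ih have "G (\<omega> i + of_nat h) ^ j \<in> ?R"
        by (intro range_fps_to_fls_closed G_R) auto
      with False show ?thesis by (auto simp: neg)
    qed
  qed
  also have "\<dots> = (\<Sum>i=1..m. if i = i0 then p (n+1) i (j0+1) else 0)"
    using j0 by (intro sum.cong refl) (auto simp: sum.delta)
  also have "\<dots> = p (n+1) i0 (j0+1)"
    using i0 by simp
  finally show ?thesis by simp
qed

section \<open>The three conditions for a Pade approximant\<close>

theorem corollary3p9:
  fixes m n k u s :: nat and r :: "nat \<Rightarrow> nat" and \<omega> :: "nat \<Rightarrow> 'a::field_char_0"
    and p :: "nat \<Rightarrow> nat \<Rightarrow> nat \<Rightarrow> 'a"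
  assumes "m \<ge> 1"
    and "\<And>i. 1 \<le> i \<Longrightarrow> i \<le> m \<Longrightarrow> r i \<ge> 1"
    and "\<And>i j. 1 \<le> i \<Longrightarrow> i < j \<Longrightarrow> j \<le> m \<Longrightarrow> \<omega> i - \<omega> j \<notin> \<int>"
    and "1 \<le> k" and "k \<le> (\<Sum>i=1..m. r i)"
    and "k = (\<Sum>i=1..u. r i) + s" and "u \<le> m - 1" and "1 \<le> s" and "s \<le> r (u+1)"
    and "F_rat m r \<omega> n u s =
      (\<Sum>i=1..m. \<Sum>h=0..n+1. \<Sum>j=1..r i. to_fract [:p h i j:] / lin (\<omega> i + of_nat h) ^ j)"
  shows "pade_approximant
      (replicate k (n+1) @ replicate ((\<Sum>i=1..m. r i) - k) n)
      (lex_family m r (\<lambda>i j. fps_binomial (\<omega> i) * fps_ln 1 ^ j))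
      (lex_family m r (P_poly n p))"
proof -
  note F = assms(10)
  define R where "R = (\<Sum>i=1..m. r i)"
  define I where "I = lex_family m r Pair"
  define ws where "ws = replicate k (n+1) @ replicate (R - k) n"
  define fs where "fs = lex_family m r (\<lambda>i j. fps_binomial (\<omega> i) * fps_ln 1 ^ j)"
  define Ps where "Ps = lex_family m r (P_poly n p)"
  have um: "u < m"
    using assms(1,7) by simp
  have kR: "k \<le> R"
    using assms(5) by (simp add: R_def)
  have len: "length ws = R" "length fs = R" "length Ps = R" "length I = R"
    using kR by (simp_all add: ws_def fs_def Ps_def I_def length_lex_family R_def)
  have "fs = map (\<lambda>(i, j). fps_binomial (\<omega> i) * fps_ln 1 ^ j) I"
    unfolding fs_def I_def by (rule lex_family_conv_map)
  moreover have "Ps = map (\<lambda>(i, j). P_poly n p i j) I"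
    unfolding Ps_def I_def by (rule lex_family_conv_map)
  ultimately have nth: "fs ! l = (case I ! l of (i, j) \<Rightarrow> fps_binomial (\<omega> i) * fps_ln 1 ^ j)"
    "Ps ! l = (case I ! l of (i, j) \<Rightarrow> P_poly n p i j)" if "l < R" for l
    using that len by simp_all

  \<comment> \<open>If all polynomials vanished, so would every partial fraction coefficient, and
    with them the nonzero function \<open>F_rat\<close>.\<close>
  have "\<exists>l<R. Ps ! l \<noteq> 0"
  proof (rule ccontr)
    assume "\<not> (\<exists>l<R. Ps ! l \<noteq> 0)"
    then have "\<forall>(i, j)\<in>set I. P_poly n p i j = 0"
      using len nth by (force simp: in_set_conv_nth)
    then have P0: "P_poly n p i j = 0" if "i \<in> {1..m}" "j < r i" for i j
      using that by (auto simp: I_def set_lex_family)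
    have "p h i j = 0" if "i \<in> {1..m}" "h \<in> {0..n+1}" "j \<in> {1..r i}" for i h j
      using sum_smult_linear_power_eq_0D[of "\<lambda>h. p h i (j - 1 + 1) / fact (j - 1)" "n+1" h]
        P0[of i "j - 1"] that unfolding P_poly_def by auto
    then have "F_rat m r \<omega> n u s = 0"
      unfolding F by (simp add: sum.neutral)
    then show False
      by (simp add: F_rat_nonzero)
  qed

  moreover have "degree (Ps ! l) \<le> ws ! l" if "l < R" for l
  proof -
    obtain i j where ij: "I ! l = (i, j)" by fastforce
    show ?thesis
    proof (cases "l < k")
      case True
      then show ?thesis
        using degree_P_poly_le[of n p i j] that by (simp add: ws_def nth_append nth ij)
    next
      case False
      then have *: "u + 1 \<le> i" "i \<le> m" "j < r i" "i = u + 1 \<Longrightarrow> s \<le> j"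
        using lex_family_nth_ge[of u m s r l i j] um assms(6,9) that ij
        by (auto simp: I_def R_def)
      \<comment> \<open>From position \<open>k\<close> on the weight is \<open>n\<close>, so the
        coefficient of \<open>(1 + z)^(n+1)\<close> has to vanish.\<close>
      have "p (n+1) i (j+1) = 0"
      proof (rule partial_fractions_pole_bound[OF _ *(1,2) um *(3,4) F])
        fix i' h
        assume i': "1 \<le> i'" "i' \<le> m" and eq: "\<omega> i' + of_nat h = \<omega> i + of_nat (n+1)"
        \<comment> \<open>Both differences are recorded because the non-integrality hypothesis is
          stated for increasing indices only.\<close>
        then have "\<omega> i' - \<omega> i = of_int (int (n+1) - int h)" "\<omega> i - \<omega> i' = of_int (int h - int (n+1))"
          by (simp_all add: algebra_simps)
        then have "i' = i"
          using assms(3)[of i' i] assms(3)[of i i'] i' *(1,2)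
          by (metis Ints_of_int le_add2 linorder_neqE_nat order.trans)
        with eq show "i' = i \<and> h = n + 1"
          by (metis add_left_cancel of_nat_eq_iff)
      qed auto
      then have "degree (P_poly n p i j) \<le> n"
        by (rule degree_P_poly_le')
      with False that show ?thesis
        by (simp add: ws_def nth_append nth ij)
    qed
  qed

  moreover have "enat ((\<Sum>l<R. ws ! l + 1) - 1) \<le> fps_ord (\<Sum>l<R. fps_of_poly (Ps ! l) * fs ! l)"
  proof -
    have "(\<Sum>l<R. fps_of_poly (Ps ! l) * fs ! l) =
        (\<Sum>l<R. case I ! l of (i, j) \<Rightarrow>
          fps_of_poly (P_poly n p i j) * (fps_binomial (\<omega> i) * fps_ln 1 ^ j))"
      by (intro sum.cong) (auto simp: nth split: prod.split)
    also have "\<dots> = exp_sum m r \<omega> n p oo fps_ln 1"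
      unfolding I_def R_def sum_lex_family exp_sum_compose_ln by simp
    finally have sum_eq: "(\<Sum>l<R. fps_of_poly (Ps ! l) * fs ! l) = exp_sum m r \<omega> n p oo fps_ln 1" .
    have split: "(\<Sum>i=1..m. r i) = (\<Sum>i=1..u. r i) + (\<Sum>i=u+1..m. r i)"
      using um sum.ub_add_nat[of 1 u r "m - u"] by simp
    have "(\<Sum>l<R. ws ! l + 1) = sum_list ws + R"
      using len by (simp add: sum_list_sum_nth atLeast0LessThan sum_Suc)
    also have "\<dots> = (\<Sum>i=1..u. Suc (n+1) * r i) + s + (\<Sum>i=u+1..m. Suc n * r i)"
    proof -
      \<comment> \<open>Writing the tail as \<open>s + d\<close> makes \<open>R - k\<close> equal to
        \<open>d\<close> and removes the truncated subtraction.\<close>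
      obtain d where "(\<Sum>i=u+1..m. r i) = s + d"
        using kR assms(6) split le_Suc_ex[of s "\<Sum>i=u+1..m. r i"] by (auto simp: R_def)
      then show ?thesis
        unfolding sum_distrib_left [symmetric]
        using assms(6) split by (simp add: ws_def sum_list_replicate R_def algebra_simps)
    qed
    finally have D: "(\<Sum>l<R. ws ! l + 1) = \<dots>" .
    \<comment> \<open>The exponent drops by one because coefficient \<open>N\<close> of the
      exponential sum comes from coefficient \<open>N + 1\<close> at infinity.\<close>
    have "fps_X ^ ((\<Sum>l<R. ws ! l + 1) - 1) dvd exp_sum m r \<omega> n p"
      unfolding D
      by (intro fps_X_power_dvdI) (simp only: exp_sum_nth, subst partial_fractions_moment[OF F], auto)
    then show ?thesis
      unfolding sum_eq by (intro enat_le_fps_ord fps_X_power_dvd_compose) auto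
  qed

  ultimately show ?thesis
    unfolding pade_approximant_def ws_def[symmetric, unfolded R_def] fs_def[symmetric] Ps_def[symmetric]
    by (simp add: len)
qed

end
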